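(* Fix $\mu\in(0,1]$. In the $(G,D,\beta,\delta)$-asymptotic regime, i.e. when $M,K,N,n_0$ all tend to infinity subject to $\mu K/N=G$, $n_0=\beta\log_2M$ and $M=DK^{1/\delta}$, an IRSA-based scheme with degree distribution $\Lambda(x)$ and decoding threshold $G^*(\Lambda)$ can achieve the following average sum rate with vanishing packet loss rate: $$\lim_{K\to\infty}R_{\mathrm{sum}}=\frac{1-\delta}{\beta}\,G,$$ for every $D>0$, $\beta\ge1$, $\delta\in(0,1)$, and $G\le G^*(\Lambda)$.
   Context: There are $K$ users, each active independently with probability $\mu$ in a frame; $\mathsf K_{\mathrm a}$ is the number of active users, so $\mathbb E[\mathsf K_{\mathrm a}]=\mu K$. A frame of $n$ channel uses is divided into $N$ slots, each of $n_0+1=n/N$ channel uses. The codebook has $M$ codewords (packets), each occupying one slot. In irregular repetition slotted ALOHA (IRSA) with degree distribution $\Lambda(x)=\sum_L\Lambda_Lx^L$, an active user sends copies of its codeword in $\mathsf L$ slots chosen uniformly without replacement, with $\mathbb P[\mathsf L=L]=\Lambda_L$. The channel load is $G=\mu K/N$. Of the $\log_2M$ bits identifying a codeword, $\log_2K$ bits are used for the user's signature, so the information rate per user is $R=\log_2(M/K)/n$ bits per channel use, and the average sum rate is $$R_{\mathrm{sum}}=\mathbb E[\mathsf K_{\mathrm a}]\,R=\frac{\mu K}{N}\cdot\frac{\log_2(M/K)}{1+n_0}.$$ The packet loss rate (PLR) is the fraction of transmitted messages that the receiver fails to decode. The decoding threshold $G^*(\Lambda)$ of the scheme is the maximum channel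 load such that, for any channel load $G\le G^*(\Lambda)$, the PLR vanishes as $N\to\infty$. In the asymptotic regime, limits are taken along sequences of parameters satisfying the stated relations, with $\mu,G,D,\beta,\delta$ fixed. *)

theory Defs
  imports "HOL-Probability.Probability"
begin

record frame_params =
  users :: nat      \<comment> \<open>\<open>K\<close>\<close>
  slots :: nat      \<comment> \<open>\<open>N\<close>\<close>
  codewords :: nat  \<comment> \<open>\<open>M\<close>\<close>
  n0 :: nat         \<comment> \<open>a slot has \<open>n0 + 1\<close> channel uses\<close>

definition frame_length :: "frame_params \<Rightarrow> nat" where
  "frame_length p = slots p * (n0 p + 1)"

text \<open>
  Everything in an IRSA-based scheme except the degree distribution. Codeword \<open>m < M\<close> is a
  sequence of \<open>n0 + 1\<close> symbols of the channel input alphabet. The field \<open>receiver\<close> is the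
  conditional law of the set of decoded codeword indices given the multiset of codewords sent in
  each slot. It is the composition of an arbitrary, possibly noisy, channel with an arbitrary
  decoder; iterative cancellation on the noiseless collision channel is one example. It does not
  see which user sent a codeword, only the codewords themselves.
\<close>

record 'x transceiver =
  codebook :: "frame_params \<Rightarrow> nat \<Rightarrow> 'x list"
  receiver :: "frame_params \<Rightarrow> (nat \<Rightarrow> 'x list multiset) \<Rightarrow> nat set pmf"

definition valid_transceiver :: "'x transceiver \<Rightarrow> bool" where
  "valid_transceiver T \<longleftrightarrow>
    (\<forall>p. \<forall>m < codewords p. length (codebook T p m) = n0 p + 1)"

text \<open>
  The state of a user is \<open>None\<close> if it is inactive, and \<open>Some (m, S)\<close> if it sends copies of
  codeword \<open>m\<close> in the set \<open>S\<close> of slots. The signature of codeword \<open>m\<close> is \<open>m mod K\<close>, so that user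
  \<open>k\<close> picks uniformly among the codewords carrying its signature (a nonempty set once \<open>K \<le> M\<close>,
  which is eventually the case in the asymptotic regime below). A degree exceeding \<open>N\<close> is
  truncated to \<open>N\<close>.
\<close>

definition user_pmf ::
    "real \<Rightarrow> nat pmf \<Rightarrow> frame_params \<Rightarrow> nat \<Rightarrow> (nat \<times> nat set) option pmf" where
  "user_pmf \<mu> \<Lambda> p k =
    bind_pmf (bernoulli_pmf \<mu>) (\<lambda>active.
      if active then
        bind_pmf (pmf_of_set {m. m < codewords p \<and> m mod users p = k}) (\<lambda>m.
        bind_pmf \<Lambda> (\<lambda>L.
        bind_pmf (pmf_of_set {S. S \<subseteq> {..<slots p} \<and> card S = min L (slots p)}) (\<lambda>S.
        return_pmf (Some (m, S)))))
      else return_pmf None)"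

definition frame_pmf ::
    "real \<Rightarrow> nat pmf \<Rightarrow> frame_params \<Rightarrow> (nat \<Rightarrow> (nat \<times> nat set) option) pmf" where
  "frame_pmf \<mu> \<Lambda> p = Pi_pmf {..<users p} None (user_pmf \<mu> \<Lambda> p)"

definition active_users ::
    "frame_params \<Rightarrow> (nat \<Rightarrow> (nat \<times> nat set) option) \<Rightarrow> nat set" where
  "active_users p x = {k. k < users p \<and> x k \<noteq> None}"

definition sent_codeword :: "(nat \<Rightarrow> (nat \<times> nat set) option) \<Rightarrow> nat \<Rightarrow> nat" where
  "sent_codeword x k = fst (the (x k))"

definition slot_input ::
    "'x transceiver \<Rightarrow> frame_params \<Rightarrow> (nat \<Rightarrow> (nat \<times> nat set) option) \<Rightarrow>
      nat \<Rightarrow> 'x list multiset" where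
  "slot_input T p x s =
    image_mset (\<lambda>k. codebook T p (sent_codeword x k))
      (mset_set {k \<in> active_users p x. s \<in> snd (the (x k))})"

definition expected_active :: "real \<Rightarrow> nat pmf \<Rightarrow> frame_params \<Rightarrow> real" where
  "expected_active \<mu> \<Lambda> p =
    measure_pmf.expectation (frame_pmf \<mu> \<Lambda> p) (\<lambda>x. real (card (active_users p x)))"

definition user_rate :: "frame_params \<Rightarrow> real" where
  "user_rate p = log 2 (real (codewords p) / real (users p)) / real (frame_length p)"

definition sum_rate :: "real \<Rightarrow> nat pmf \<Rightarrow> frame_params \<Rightarrow> real" where
  "sum_rate \<mu> \<Lambda> p = expected_active \<mu> \<Lambda> p * user_rate p"

text \<open>
  The packet loss rate is the expected fraction of lost messages; the fraction is \<open>0 / 0 = 0\<close> when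
  nobody is active. As the fraction lies in \<open>[0, 1]\<close>, its expectation vanishes in a limit iff the
  random fraction vanishes in probability.
\<close>

definition plr :: "real \<Rightarrow> 'x transceiver \<Rightarrow> nat pmf \<Rightarrow> frame_params \<Rightarrow> real" where
  "plr \<mu> T \<Lambda> p =
    measure_pmf.expectation
      (bind_pmf (frame_pmf \<mu> \<Lambda> p) (\<lambda>x.
        map_pmf (\<lambda>decoded. (x, decoded)) (receiver T p (slot_input T p x))))
      (\<lambda>(x, decoded).
        real (card {k \<in> active_users p x. sent_codeword x k \<notin> decoded}) /
        real (card (active_users p x)))"

text \<open>
  The relations \<open>\<mu> K / N = G\<close>, \<open>M = D K powr (1/\<delta>)\<close> and \<open>n0 = \<beta> log 2 M\<close> between integers are
  required up to integer rounding. Sequences satisfying them exactly are included, but for most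
  real \<open>G, D, \<beta>, \<delta>\<close> there are none.
\<close>

definition asymptotic_regime ::
    "real \<Rightarrow> real \<Rightarrow> real \<Rightarrow> real \<Rightarrow> real \<Rightarrow> (nat \<Rightarrow> frame_params) \<Rightarrow> bool" where
  "asymptotic_regime \<mu> G D \<beta> \<delta> p \<longleftrightarrow>
    filterlim (\<lambda>j. users (p j)) at_top sequentially \<and>
    filterlim (\<lambda>j. slots (p j)) at_top sequentially \<and>
    filterlim (\<lambda>j. codewords (p j)) at_top sequentially \<and>
    filterlim (\<lambda>j. n0 (p j)) at_top sequentially \<and>
    (\<forall>j. \<bar>real (users (p j)) - G * real (slots (p j)) / \<mu>\<bar> < 1) \<and>
    (\<forall>j. \<bar>real (codewords (p j)) - D * real (users (p j)) powr (1 / \<delta>)\<bar> < 1) \<and>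
    (\<forall>j. \<bar>real (n0 (p j)) - \<beta> * log 2 (real (codewords (p j)))\<bar> < 1)"

definition plr_vanishes_at :: "real \<Rightarrow> 'x transceiver \<Rightarrow> nat pmf \<Rightarrow> real \<Rightarrow> bool" where
  "plr_vanishes_at \<mu> T \<Lambda> G \<longleftrightarrow>
    (\<forall>D \<beta> \<delta> p. D > 0 \<longrightarrow> \<beta> \<ge> 1 \<longrightarrow> 0 < \<delta> \<longrightarrow> \<delta> < 1 \<longrightarrow> asymptotic_regime \<mu> G D \<beta> \<delta> p \<longrightarrow>
      (\<lambda>j. plr \<mu> T \<Lambda> (p j)) \<longlonglongrightarrow> 0)"

text \<open>
  The threshold is a maximum, not merely a supremum: at a supremum that is not attained the packet
  loss rate need not vanish.
\<close>

definition is_decoding_threshold :: "real \<Rightarrow> 'x transceiver \<Rightarrow> nat pmf \<Rightarrow> real \<Rightarrow> bool" where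
  "is_decoding_threshold \<mu> T \<Lambda> Gstar \<longleftrightarrow>
    (let A = {g. g \<ge> 0 \<and> (\<forall>G. 0 < G \<and> G \<le> g \<longrightarrow> plr_vanishes_at \<mu> T \<Lambda> G)}
     in Gstar \<in> A \<and> (\<forall>g \<in> A. g \<le> Gstar))"

end

theory Submission
  imports Defs "HOL-Real_Asymp.Real_Asymp"
begin

text \<open>
  The packet loss rate vanishes because \<open>G\<close> is at most the threshold. For the rate,
  \<open>E[K\<^sub>a] = \<mu> K\<close>, so \<open>R\<^sub>s\<^sub>u\<^sub>m = (\<mu> K / N) (log\<^sub>2 M - log\<^sub>2 K) / (n\<^sub>0 + 1)\<close>. Integer rounding changes
  each of the defining relations by a bounded amount, hence \<open>\<mu> K / N \<longlonglongrightarrow> G\<close>,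
  \<open>n\<^sub>0 / log\<^sub>2 M \<longlonglongrightarrow> \<beta>\<close> and, as \<open>log\<^sub>2 M = log\<^sub>2 D + (log\<^sub>2 K) / \<delta> + o(1)\<close>,
  \<open>log\<^sub>2 K / log\<^sub>2 M \<longlonglongrightarrow> \<delta>\<close>.
\<close>

text \<open>The error \<open>u j / v j - c\<close> is at most \<open>C / v j\<close>, and
  \<open>v\<close> diverges. This absorbs the integer rounding in all three relations of the
  regime.\<close>

lemma tendsto_ratio_of_bounded_diff:
  fixes u v :: "'a \<Rightarrow> real"
  assumes bound: "\<And>j. \<bar>u j - c * v j\<bar> \<le> C" and v: "filterlim v at_top F"
  shows "((\<lambda>j. u j / v j) \<longlongrightarrow> c) F"
proof -
  have "((\<lambda>j. C / v j) \<longlongrightarrow> 0) F"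
    by (rule real_tendsto_divide_at_top[OF tendsto_const v])
  moreover have "\<forall>\<^sub>F j in F. norm (u j / v j - c) \<le> C / v j"
    using filterlim_at_top_dense[THEN iffD1, OF v, rule_format, of 0]
  proof eventually_elim
    case (elim j)
    then have "u j / v j - c = (u j - c * v j) / v j" by (simp add: field_simps)
    then have "norm (u j / v j - c) = \<bar>u j - c * v j\<bar> / v j" using elim by simp
    then show ?case using bound[of j] elim by (simp add: divide_right_mono)
  qed
  ultimately have "((\<lambda>j. u j / v j - c) \<longlongrightarrow> 0) F"
    by (rule Lim_null_comparison[rotated])
  then show ?thesis by (rule LIM_zero_cancel)
qed

text \<open>The choices of codeword, degree and slots always end in \<open>Some\<close>, so under
  the map to the activity flag they collapse to a constant and only the Bernoulli variable is left.
  This covers the case where \<open>pmf_of_set\<close> is applied to an empty set.\<close>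

lemma prob_user_active:
  assumes "0 \<le> \<mu>" "\<mu> \<le> 1"
  shows "measure_pmf.prob (user_pmf \<mu> \<Lambda> p k) {y. y \<noteq> None} = \<mu>"
proof -
  have "map_pmf (\<lambda>y. y \<noteq> None) (user_pmf \<mu> \<Lambda> p k) =
      bind_pmf (bernoulli_pmf \<mu>) return_pmf"
    unfolding user_pmf_def map_bind_pmf
    by (intro bind_pmf_cong refl)
      (simp add: map_bind_pmf map_pmf_comp flip: map_pmf_def)
  then have "map_pmf (\<lambda>y. y \<noteq> None) (user_pmf \<mu> \<Lambda> p k) = bernoulli_pmf \<mu>"
    by (simp add: bind_return_pmf')
  then have "pmf (map_pmf (\<lambda>y. y \<noteq> None) (user_pmf \<mu> \<Lambda> p k)) True = \<mu>"
    using assms by simp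
  then show ?thesis by (simp add: pmf_map vimage_def)
qed

text \<open>Linearity of expectation: the number of active users is a sum of indicators, and the
  marginal of the product at user \<open>k\<close> is \<open>user_pmf\<close>.\<close>

lemma expected_active_eq:
  assumes "0 \<le> \<mu>" "\<mu> \<le> 1"
  shows "expected_active \<mu> \<Lambda> p = \<mu> * real (users p)"
proof -
  have card_eq: "real (card (active_users p x)) = (\<Sum>k<users p. indicator {x. x k \<noteq> None} x)"
    for x
  proof -
    have "active_users p x = {..<users p} \<inter> {k. x k \<noteq> None}"
      by (auto simp: active_users_def)
    then show ?thesis by (simp add: indicator_def sum.If_cases)
  qed
  have active: "measure_pmf.prob (frame_pmf \<mu> \<Lambda> p) {x. x k \<noteq> None} = \<mu>" if "k < users p" for k
  proof -
    have "map_pmf (\<lambda>x. x k) (frame_pmf \<mu> \<Lambda> p) = user_pmf \<mu> \<Lambda> p k"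
      unfolding frame_pmf_def using that by (subst Pi_pmf_component) auto
    then have "measure_pmf.prob (user_pmf \<mu> \<Lambda> p k) {y. y \<noteq> None} =
        measure_pmf.prob (frame_pmf \<mu> \<Lambda> p) ((\<lambda>x. x k) -` {y. y \<noteq> None})"
      by (metis measure_map_pmf)
    then show ?thesis using prob_user_active[OF assms] by (simp add: vimage_def)
  qed
  have "expected_active \<mu> \<Lambda> p =
      (\<Sum>k<users p. measure_pmf.expectation (frame_pmf \<mu> \<Lambda> p) (indicator {x. x k \<noteq> None}))"
    unfolding expected_active_def card_eq
    by (rule Bochner_Integration.integral_sum)
      (simp add: integrable_real_indicator measure_pmf.emeasure_finite less_top[symmetric])
  also have "\<dots> = (\<Sum>k<users p. \<mu>)"
    by (intro sum.cong refl) (simp add: active del: not_None_eq)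
  finally show ?thesis by simp
qed

lemma sum_rate_tendsto:
  assumes \<mu>: "0 < \<mu>" "\<mu> \<le> 1" and D: "D > 0" and \<delta>: "0 < \<delta>"
    and \<beta>: "\<beta> \<noteq> 0" and regime: "asymptotic_regime \<mu> G D \<beta> \<delta> p"
  shows "(\<lambda>j. sum_rate \<mu> \<Lambda> (p j)) \<longlonglongrightarrow> (1 - \<delta>) / \<beta> * G"
proof -
  define K where "K j = real (users (p j))" for j
  define N where "N j = real (slots (p j))" for j
  define M where "M j = real (codewords (p j))" for j
  define m where "m j = real (n0 (p j))" for j
  have K: "filterlim K at_top sequentially" and N: "filterlim N at_top sequentially"
    and M: "filterlim M at_top sequentially"
    and KN: "\<And>j. \<bar>K j - G * N j / \<mu>\<bar> < 1"
    and MK: "\<And>j. \<bar>M j - D * K j powr (1 / \<delta>)\<bar> < 1"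
    and mM: "\<And>j. \<bar>m j - \<beta> * log 2 (M j)\<bar> < 1"
    using regime unfolding asymptotic_regime_def K_def N_def M_def m_def
    by (auto intro: filterlim_compose[OF filterlim_real_sequentially])
  have log_M: "filterlim (\<lambda>j. log 2 (M j)) at_top sequentially"
    by (rule filterlim_compose[OF _ M]) real_asymp
  have K_pos: "\<forall>\<^sub>F j in sequentially. K j > 0" and M_pos: "\<forall>\<^sub>F j in sequentially. M j > 0"
    using K M by (simp_all add: filterlim_at_top_dense)
  have log_nz: "\<forall>\<^sub>F j in sequentially. log 2 (M j) \<noteq> 0"
    using log_M[unfolded filterlim_at_top_dense, rule_format, of 0] by eventually_elim linarith

  have "(\<lambda>j. K j / N j) \<longlonglongrightarrow> G / \<mu>"
    using KN by (intro tendsto_ratio_of_bounded_diff[where C = 1] N) (simp add: less_imp_le)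
  then have "(\<lambda>j. \<mu> * (K j / N j)) \<longlonglongrightarrow> \<mu> * (G / \<mu>)"
    by (rule tendsto_mult_left)
  then have load: "(\<lambda>j. \<mu> * K j / N j) \<longlonglongrightarrow> G"
    using \<mu> by simp

  have slot: "(\<lambda>j. (m j + 1) / log 2 (M j)) \<longlonglongrightarrow> \<beta>"
  \<comment> \<open>The constant 2 is the rounding error, below 1, plus the extra channel use in
    \<open>m j + 1\<close>.\<close>
  proof (rule tendsto_ratio_of_bounded_diff[where C = 2, OF _ log_M])
    show "\<bar>m j + 1 - \<beta> * log 2 (M j)\<bar> \<le> 2" for j
      using mM[of j] by linarith
  qed

  \<comment> \<open>\<open>A j\<close> is the unrounded value of \<open>M j\<close>. A bounded
    additive error becomes a factor \<open>M j / A j\<close> tending to 1, hence an additive error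
    o(1) after taking logarithms.\<close>
  define A where "A j = D * K j powr (1 / \<delta>)" for j
  have "filterlim (\<lambda>j. K j powr (1 / \<delta>)) at_top sequentially"
    by (rule filterlim_compose[OF _ K]) (use \<delta> in real_asymp)
  then have A: "filterlim A at_top sequentially"
    unfolding A_def using D by (intro filterlim_tendsto_pos_mult_at_top[OF tendsto_const])
  have "(\<lambda>j. M j / A j) \<longlonglongrightarrow> 1"
    using MK by (intro tendsto_ratio_of_bounded_diff[where C = 1] A)
      (simp add: A_def less_imp_le)
  then have "(\<lambda>j. log 2 (M j / A j)) \<longlonglongrightarrow> log 2 1"
    by (intro tendsto_intros) auto
  then have "(\<lambda>j. (log 2 (M j / A j) + log 2 D) / log 2 (M j)) \<longlonglongrightarrow> 0"
    by (rule real_tendsto_divide_at_top[OF tendsto_add[OF _ tendsto_const] log_M])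
  then have "(\<lambda>j. \<delta> * (1 - (log 2 (M j / A j) + log 2 D) / log 2 (M j))) \<longlonglongrightarrow> \<delta> * (1 - 0)"
    by (intro tendsto_mult_left tendsto_diff tendsto_const)
  \<comment> \<open>Expand log A = log D + (log K) / \<delta> and solve for log K.\<close>
  moreover have "\<forall>\<^sub>F j in sequentially.
      \<delta> * (1 - (log 2 (M j / A j) + log 2 D) / log 2 (M j)) = log 2 (K j) / log 2 (M j)"
    using K_pos M_pos log_nz
  proof eventually_elim
    case (elim j)
    then have "log 2 (M j / A j) + log 2 D = log 2 (M j) - log 2 (K j) / \<delta>"
      using D by (simp add: A_def log_divide log_mult log_powr)
    then show ?case using elim \<delta> by (simp only: diff_divide_distrib) simp
  qed
  ultimately have signature: "(\<lambda>j. log 2 (K j) / log 2 (M j)) \<longlonglongrightarrow> \<delta>"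
    by (simp add: tendsto_cong)

  \<comment> \<open>Dividing both log M - log K and \<open>m j + 1\<close> by log M gives factors
    with finite limits, the one in the denominator being the nonzero \<beta>.\<close>
  have "(\<lambda>j. \<mu> * K j / N j *
      ((1 - log 2 (K j) / log 2 (M j)) / ((m j + 1) / log 2 (M j)))) \<longlonglongrightarrow> G * ((1 - \<delta>) / \<beta>)"
    by (intro tendsto_mult[OF load] tendsto_divide slot \<beta>
        tendsto_diff tendsto_const signature)
  moreover have "\<forall>\<^sub>F j in sequentially.
      \<mu> * K j / N j * ((1 - log 2 (K j) / log 2 (M j)) / ((m j + 1) / log 2 (M j))) =
      sum_rate \<mu> \<Lambda> (p j)"
    \<comment> \<open>Positivity of \<open>K j\<close> and \<open>M j\<close> splits the logarithm
      of the quotient, and log M cancels because it is nonzero. If \<open>N j = 0\<close>, both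
      sides are 0 by the convention x / 0 = 0.\<close>
    using K_pos M_pos log_nz
  proof eventually_elim
    case (elim j)
    have rate: "sum_rate \<mu> \<Lambda> (p j) = \<mu> * K j * ((log 2 (M j) - log 2 (K j)) / (N j * (m j + 1)))"
      using elim \<mu> by (simp add: sum_rate_def expected_active_eq user_rate_def frame_length_def
          K_def N_def M_def m_def log_divide algebra_simps)
    have "1 - log 2 (K j) / log 2 (M j) = (log 2 (M j) - log 2 (K j)) / log 2 (M j)"
      using elim(3) by (simp only: diff_divide_distrib) simp
    then show ?case unfolding rate using elim(3) by simp
  qed
  ultimately show ?thesis by (simp add: tendsto_cong mult.commute)
qed

theorem theorem3:
  fixes \<mu> G D \<beta> \<delta> Gstar :: real
    and \<Lambda> :: "nat pmf"
    and T :: "'x transceiver"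
    and p :: "nat \<Rightarrow> frame_params"
  assumes "0 < \<mu>" and "\<mu> \<le> 1"
    and "valid_transceiver T"
    and "is_decoding_threshold \<mu> T \<Lambda> Gstar"
    and "D > 0" and "\<beta> \<ge> 1" and "0 < \<delta>" and "\<delta> < 1"
    and "0 < G" and "G \<le> Gstar"
    and "asymptotic_regime \<mu> G D \<beta> \<delta> p"
  shows "(\<lambda>j. sum_rate \<mu> \<Lambda> (p j)) \<longlonglongrightarrow> (1 - \<delta>) / \<beta> * G
    \<and> (\<lambda>j. plr \<mu> T \<Lambda> (p j)) \<longlonglongrightarrow> 0"
proof
  show "(\<lambda>j. sum_rate \<mu> \<Lambda> (p j)) \<longlonglongrightarrow> (1 - \<delta>) / \<beta> * G"
    using assms by (intro sum_rate_tendsto) auto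
  \<comment> \<open>The threshold is an attained maximum, so the case \<open>G = Gstar\<close> is
    included.\<close>
  have "plr_vanishes_at \<mu> T \<Lambda> G"
    using assms by (auto simp: is_decoding_threshold_def Let_def)
  then show "(\<lambda>j. plr \<mu> T \<Lambda> (p j)) \<longlonglongrightarrow> 0"
    using assms unfolding plr_vanishes_at_def by blast
qed

end
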